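(* For any $c>0$ there exist $n\in\mathbb N$ and trees $T_1=([n],E_1)$, $T_2=([n],E_2)$ on vertex set $[n]$ such that for every permutation $\varphi\in S_n$, the union of $T_1$ and $T_2$ along $\varphi$ has treewidth at least $c$.
   Context: $[n]=\{1,\dots,n\}$ and $S_n$ is the group of permutations of $[n]$. For $\varphi\in S_n$ and $E\subseteq\binom{[n]}{2}$, $\varphi(E)=\{\{\varphi(i),\varphi(j)\}:\{i,j\}\in E\}$. The union of $G_1=([n],E_1)$ and $G_2=([n],E_2)$ along $\varphi$ is the graph $([n],\varphi(E_1)\cup E_2)$. *)

theory Defs
  imports Complex_Main "HOL-Combinatorics.Permutations"
begin

text \<open>A simple graph is given by its vertex set \<open>V\<close> and a set \<open>E\<close> of two-element subsets of \<open>V\<close>.\<close>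

definition simple_graph :: "'a set \<Rightarrow> 'a set set \<Rightarrow> bool" where
  "simple_graph V E \<longleftrightarrow> finite V \<and> E \<subseteq> {e. e \<subseteq> V \<and> card e = 2}"

text \<open>
  \<open>connected_graph S E\<close> only uses the edges of \<open>E\<close> with both ends in \<open>S\<close>, so for \<open>S \<subseteq> V\<close> it states
  that the subgraph of \<open>(V, E)\<close> induced by \<open>S\<close> is connected. The empty graph is not connected.
\<close>

definition connected_graph :: "'a set \<Rightarrow> 'a set set \<Rightarrow> bool" where
  "connected_graph S E \<longleftrightarrow>
     S \<noteq> {} \<and> (\<forall>u\<in>S. \<forall>v\<in>S. (\<lambda>x y. x \<in> S \<and> y \<in> S \<and> {x, y} \<in> E)\<^sup>*\<^sup>* u v)"

definition is_cycle :: "'a set set \<Rightarrow> 'a list \<Rightarrow> bool" where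
  "is_cycle E xs \<longleftrightarrow> length xs \<ge> 3 \<and> distinct xs \<and>
     (\<forall>i<length xs. {xs ! i, xs ! (Suc i mod length xs)} \<in> E)"

definition is_tree :: "'a set \<Rightarrow> 'a set set \<Rightarrow> bool" where
  "is_tree V E \<longleftrightarrow> simple_graph V E \<and> connected_graph V E \<and> (\<nexists>xs. is_cycle E xs)"

text \<open>\<open>(I, F)\<close> is the decomposition tree and \<open>B t\<close> is the bag at the node \<open>t\<close>.\<close>

definition tree_decomposition ::
  "'a set \<Rightarrow> 'a set set \<Rightarrow> 'b set \<Rightarrow> 'b set set \<Rightarrow> ('b \<Rightarrow> 'a set) \<Rightarrow> bool" where
  "tree_decomposition V E I F B \<longleftrightarrow>
     is_tree I F \<and>
     (\<Union>t\<in>I. B t) = V \<and>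
     (\<forall>e\<in>E. \<exists>t\<in>I. e \<subseteq> B t) \<and>
     (\<forall>v\<in>V. connected_graph {t \<in> I. v \<in> B t} F)"

text \<open>The subtraction only truncates when all bags are empty, that is, when \<open>V = {}\<close>.\<close>

definition decomposition_width :: "'b set \<Rightarrow> ('b \<Rightarrow> 'a set) \<Rightarrow> nat" where
  "decomposition_width I B = Max ((\<lambda>t. card (B t)) ` I) - 1"

text \<open>
  Every finite tree is isomorphic to one whose nodes are natural numbers, so restricting the
  node type of the decomposition tree to \<^typ>\<open>nat\<close> does not change the minimum.
\<close>

definition treewidth :: "'a set \<Rightarrow> 'a set set \<Rightarrow> nat" where
  "treewidth V E = (LEAST w. \<exists>(I :: nat set) F B.
     tree_decomposition V E I F B \<and> decomposition_width I B = w)"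

text \<open>The one-bag decomposition shows that the minimum is taken over a nonempty set.\<close>

lemma ex_tree_decomposition:
  assumes "simple_graph V E"
  shows "\<exists>(I :: nat set) F B. tree_decomposition V E I F B"
proof -
  have "tree_decomposition V E {0 :: nat} {} (\<lambda>_. V)"
    using assms
    by (auto simp: tree_decomposition_def is_tree_def simple_graph_def connected_graph_def
        is_cycle_def intro!: exI[of _ 0])
  then show ?thesis by blast
qed

lemma treewidth_attained:
  assumes "simple_graph V E"
  shows "\<exists>(I :: nat set) F B. tree_decomposition V E I F B \<and> decomposition_width I B = treewidth V E"
  unfolding treewidth_def
  by (rule LeastI_ex) (use ex_tree_decomposition[OF assms] in blast)

definition map_edges :: "('a \<Rightarrow> 'b) \<Rightarrow> 'a set set \<Rightarrow> 'b set set" where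
  "map_edges \<phi> E = {{\<phi> i, \<phi> j} | i j. {i, j} \<in> E}"

definition union_along :: "('a \<Rightarrow> 'a) \<Rightarrow> 'a set set \<Rightarrow> 'a set set \<Rightarrow> 'a set set" where
  "union_along \<phi> E1 E2 = map_edges \<phi> E1 \<union> E2"

end

theory Submission
  imports Defs "HOL-Library.Transitive_Closure_Table" "HOL-Library.Log_Nat"
begin

text \<open>
  A graph of treewidth less than \<open>k\<close> has, at every scale \<open>x\<close>, a vertex set \<open>A\<close> with
  \<open>x - k \<le> |A| < 2x\<close> whose boundary is contained in a set of at most \<open>k\<close> vertices. In a complete
  binary tree, a set with so small a boundary has a size of the form \<open>\<Sum> \<plusminus> (2 ^ i - 1)\<close> with \<open>O(k)\<close>
  terms, so only polylogarithmically many sizes occur. Let \<open>T\<^sub>1\<close> consist of \<open>\<theta>\<close> complete binary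
  trees of height \<open>h\<close> joined together, and let \<open>T\<^sub>2\<close> be one such tree with each node replaced by a
  path of \<open>\<theta>\<close> vertices. In \<open>T\<^sub>2\<close> the sizes are \<open>\<theta>\<close> times the former ones, up to an error
  \<open>\<theta>k\<close>. If the union has small treewidth, then \<open>A\<close> has small boundary in both trees, so \<open>\<theta>\<close> is
  approximately a ratio \<open>u / u'\<close> of two such sizes. At a large enough scale \<open>x\<close> every pair
  \<open>(u, u')\<close> is used by at most one \<open>\<theta>\<close>, hence some \<open>\<theta>\<close> in a polylogarithmic range is used by none.
\<close>

section \<open>Separations from tree decompositions\<close>

definition adj_in :: "'a set \<Rightarrow> 'a set set \<Rightarrow> 'a \<Rightarrow> 'a \<Rightarrow> bool" where
  "adj_in S E x y \<longleftrightarrow> x \<in> S \<and> y \<in> S \<and> {x, y} \<in> E"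

lemma connected_graph_adj_in:
  "connected_graph S E \<longleftrightarrow> S \<noteq> {} \<and> (\<forall>u\<in>S. \<forall>v\<in>S. (adj_in S E)\<^sup>*\<^sup>* u v)"
  unfolding connected_graph_def adj_in_def[abs_def] ..

lemma adj_in_rtranclp_sym:
  assumes "(adj_in S E)\<^sup>*\<^sup>* x y"
  shows "(adj_in S E)\<^sup>*\<^sup>* y x"
proof -
  have "symp (adj_in S E)" by (auto simp: symp_def adj_in_def insert_commute)
  then show ?thesis using assms symp_rtranclp by (metis sympD)
qed

lemma adj_in_rtranclp_mono:
  assumes "(adj_in S E)\<^sup>*\<^sup>* x y" "S \<subseteq> S'"
  shows "(adj_in S' E)\<^sup>*\<^sup>* x y"
proof -
  have "adj_in S E \<le> adj_in S' E" using assms(2) by (auto simp: adj_in_def)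
  then show ?thesis using assms(1) rtranclp_mono by blast
qed

lemma adj_in_rtranclp_mem:
  assumes "(adj_in S E)\<^sup>*\<^sup>* x y" "x \<in> S"
  shows "y \<in> S"
  using assms by (induction rule: rtranclp_induct) (auto simp: adj_in_def)

text \<open>A simple path from \<open>t\<close> to \<open>t'\<close> avoiding \<open>s\<close> would
  close up through \<open>s\<close> to a cycle.\<close>

lemma tree_neighbours_separated:
  assumes tree: "is_tree I F" and e: "{s, t} \<in> F" "{s, t'} \<in> F" and neq: "t \<noteq> t'"
  shows "\<not> (adj_in (I - {s}) F)\<^sup>*\<^sup>* t t'"
proof
  assume "(adj_in (I - {s}) F)\<^sup>*\<^sup>* t t'"
  then obtain xs0 where "rtrancl_path (adj_in (I - {s}) F) t xs0 t'"
    using rtranclp_eq_rtrancl_path by metis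
  then obtain xs where p: "rtrancl_path (adj_in (I - {s}) F) t xs t'" and d: "distinct (t # xs)"
    by (rule rtrancl_path_distinct)
  have ne: "xs \<noteq> []" using p neq by (auto elim: rtrancl_path.cases)
  have last: "last xs = t'" using rtrancl_path_last[OF p ne] .
  have step: "adj_in (I - {s}) F ((t # xs) ! i) (xs ! i)" if "i < length xs" for i
    using rtrancl_path_nth[OF p that] .
  have s1: "t \<noteq> s" using step[of 0] ne by (auto simp: adj_in_def)
  have s2: "s \<notin> set xs"
  proof
    assume "s \<in> set xs"
    then obtain i where "i < length xs" "xs ! i = s" by (auto simp: in_set_conv_nth)
    then show False using step[of i] by (auto simp: adj_in_def)
  qed
  have "is_cycle F (s # t # xs)"
    unfolding is_cycle_def
  proof (intro conjI allI impI)
    show "length (s # t # xs) \<ge> 3" using ne by (cases xs) auto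
    show "distinct (s # t # xs)" using d s1 s2 by auto
    fix i assume i: "i < length (s # t # xs)"
    consider "i = 0" | j where "i = Suc j" "j < length xs" | "i = Suc (length xs)"
      using i by (cases i) (auto, linarith)
    then show "{(s # t # xs) ! i, (s # t # xs) ! (Suc i mod length (s # t # xs))} \<in> F"
    proof cases
      case 1 then show ?thesis using e by simp
    next
      case 2 then show ?thesis using step[of j] by (simp add: adj_in_def)
    next
      case 3 then show ?thesis using e last ne by (simp add: last_conv_nth insert_commute nth_Cons')
    qed
  qed
  then show False using tree by (auto simp: is_tree_def)
qed

text \<open>For \<open>q\<close> in \<open>I - {s}\<close> this is the branch of the tree at
  \<open>s\<close> that contains \<open>q\<close>: its component once \<open>s\<close> is
  deleted.\<close>

definition comp_of :: "'b set \<Rightarrow> 'b set set \<Rightarrow> 'b \<Rightarrow> 'b \<Rightarrow> 'b set" where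
  "comp_of I F s q = {p. (adj_in (I - {s}) F)\<^sup>*\<^sup>* q p}"

lemma comp_of_subset: "q \<in> I - {s} \<Longrightarrow> comp_of I F s q \<subseteq> I - {s}"
  unfolding comp_of_def using adj_in_rtranclp_mem by fast

lemma comp_of_self: "q \<in> comp_of I F s q"
  by (simp add: comp_of_def)

lemma comp_of_step:
  assumes "p \<in> comp_of I F s q" "adj_in (I - {s}) F p p'"
  shows "p' \<in> comp_of I F s q"
  using assms by (auto simp: comp_of_def)

text \<open>The neighbour is the node just before the first visit to \<open>s\<close> on a path from
  \<open>q\<close>.\<close>

lemma neighbour_in_comp_of:
  assumes "(adj_in I F)\<^sup>*\<^sup>* q s" "q \<noteq> s"
  shows "\<exists>t \<in> comp_of I F s q. t \<in> I - {s} \<and> {s, t} \<in> F"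
  using assms
proof (induction rule: converse_rtranclp_induct)
  case base
  then show ?case by simp
next
  case (step q q')
  show ?case
  proof (cases "q' = s")
    case True
    then show ?thesis using step comp_of_self[of q I F s]
      by (auto simp: adj_in_def insert_commute)
  next
    case False
    with step obtain t where t: "t \<in> comp_of I F s q'" "t \<in> I - {s}" "{s, t} \<in> F" by blast
    have "adj_in (I - {s}) F q q'" using step False by (auto simp: adj_in_def)
    then have "t \<in> comp_of I F s q"
      using t(1) by (auto simp: comp_of_def intro: converse_rtranclp_into_rtranclp)
    with t show ?thesis by blast
  qed
qed

text \<open>If no branch is big, any node \<open>t\<close> works with all its branches. Otherwise
  take a smallest big branch \<open>?K\<close>, at a node \<open>s\<close>, and let \<open>t\<close>
  be a node of \<open>?K\<close> adjacent to \<open>s\<close>. The branches at \<open>t\<close> that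
  start inside \<open>?K\<close> stay inside it, so they are smaller and not big, while together
  with \<open>t\<close> they make up \<open>?K\<close>.\<close>

lemma tree_node_with_small_components:
  assumes tree: "is_tree I F" and big: "big I"
  shows "\<exists>t\<in>I. \<exists>Q \<subseteq> I - {t}. (\<forall>q\<in>Q. \<not> big (comp_of I F t q)) \<and>
           big (insert t (\<Union>q\<in>Q. comp_of I F t q))"
proof (cases "\<exists>s\<in>I. \<exists>q\<in>I - {s}. big (comp_of I F s q)")
  case False
  obtain t where t: "t \<in> I" using tree by (auto simp: is_tree_def connected_graph_def)
  have "insert t (\<Union>q\<in>I - {t}. comp_of I F t q) = I"
    using t comp_of_subset[of _ I t F] comp_of_self[of _ I F t] by blast
  then show ?thesis using False t big by (intro bexI[of _ t] exI[of _ "I - {t}"]) auto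
next
  case True
  define P where "P = (\<lambda>(s, q). s \<in> I \<and> q \<in> I - {s} \<and> big (comp_of I F s q))"
  have "\<exists>sq. P sq" using True by (auto simp: P_def)
  then obtain sq where "P sq" and
    min0: "\<And>z. P z \<Longrightarrow> card (case sq of (s, q) \<Rightarrow> comp_of I F s q) \<le> card (case z of (s, q) \<Rightarrow> comp_of I F s q)"
    using ex_has_least_nat[of P _ "\<lambda>z. card (case z of (s, q) \<Rightarrow> comp_of I F s q)"] by metis
  obtain s q where sq: "sq = (s, q)" by force
  have s: "s \<in> I" "q \<in> I - {s}" "big (comp_of I F s q)"
    using \<open>P sq\<close> by (auto simp: P_def sq)
  have min: "card (comp_of I F s q) \<le> card (comp_of I F s' q')"
    if "s' \<in> I" "q' \<in> I - {s'}" "big (comp_of I F s' q')" for s' q'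
    using min0[of "(s', q')"] that by (auto simp: P_def sq)
  let ?K = "comp_of I F s q"
  have KI: "?K \<subseteq> I - {s}" using comp_of_subset s(2) .
  have fin: "finite I" using tree by (auto simp: is_tree_def simple_graph_def)
  have "(adj_in I F)\<^sup>*\<^sup>* q s" using tree s by (auto simp: is_tree_def connected_graph_adj_in)
  then obtain t where t: "t \<in> ?K" "t \<in> I - {s}" "{s, t} \<in> F"
    using neighbour_in_comp_of s(2) by (metis DiffD2 insertI1)
  have sub: "comp_of I F t q' \<subseteq> ?K - {t}" if q': "q' \<in> ?K - {t}" for q'
  proof
    fix p assume "p \<in> comp_of I F t q'"
    then have "(adj_in (I - {t}) F)\<^sup>*\<^sup>* q' p" by (simp add: comp_of_def)
    then show "p \<in> ?K - {t}"
    proof (induction rule: rtranclp_induct)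
      case base
      then show ?case using q' .
    next
      case (step p p')
      \<comment> \<open>Otherwise \<open>p\<close> and \<open>t\<close> are distinct neighbours of
        \<open>s\<close> in one component of the tree without \<open>s\<close>.\<close>
      have "p' \<noteq> s"
      proof
        assume "p' = s"
        then have e: "{s, p} \<in> F" using step by (auto simp: adj_in_def insert_commute)
        have "(adj_in (I - {s}) F)\<^sup>*\<^sup>* t p"
          using t(1) step(3) adj_in_rtranclp_sym[of "I - {s}" F q t]
          by (auto simp: comp_of_def)
        then show False using tree_neighbours_separated[OF tree t(3) e] step(3) by blast
      qed
      then have "adj_in (I - {s}) F p p'" using step KI by (auto simp: adj_in_def)
      then have "p' \<in> ?K" using step comp_of_step by fast
      then show ?case using step by (auto simp: adj_in_def)
    qed
  qed
  have small: "\<not> big (comp_of I F t q')" if q': "q' \<in> ?K - {t}" for q'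
  proof
    assume b: "big (comp_of I F t q')"
    have "comp_of I F t q' \<subset> ?K" using sub[OF q'] t(1) by blast
    then have "card (comp_of I F t q') < card ?K"
      using fin KI by (meson finite_Diff finite_subset psubset_card_mono)
    moreover have "card ?K \<le> card (comp_of I F t q')"
      using min[of t q'] b t q' KI by blast
    ultimately show False by simp
  qed
  have "insert t (\<Union>q'\<in>?K - {t}. comp_of I F t q') = ?K"
    using t(1) sub comp_of_self[of _ I F t] by blast
  then show ?thesis using small s(3) t(2) KI
    by (intro bexI[of _ t] exI[of _ "?K - {t}"]) auto
qed

text \<open>Add the members one at a time: when the union first reaches \<open>y\<close> elements,
  the last member has added fewer than \<open>x\<close>.\<close>

lemma subfamily_with_card_between:
  fixes f :: "'b \<Rightarrow> 'a set"
  assumes "finite Q" "\<And>q. q \<in> Q \<Longrightarrow> finite (f q) \<and> card (f q) < x" "y \<le> card (\<Union>q\<in>Q. f q)" "x > 0"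
  shows "\<exists>Q'\<subseteq>Q. y \<le> card (\<Union>q\<in>Q'. f q) \<and> card (\<Union>q\<in>Q'. f q) < y + x"
  using assms
proof (induction rule: finite_induct)
  case empty
  then show ?case by simp
next
  case (insert a Q)
  show ?case
  proof (cases "y \<le> card (\<Union>q\<in>Q. f q)")
    case True
    with insert show ?thesis by (meson insertCI subset_insertI2)
  next
    case False
    have "card (\<Union>q\<in>insert a Q. f q) \<le> card (f a) + card (\<Union>q\<in>Q. f q)"
      by (simp add: card_Un_le)
    also have "\<dots> < y + x" using False insert.prems(1)[of a] by simp
    finally show ?thesis using insert.prems by (intro exI[of _ "insert a Q"]) auto
  qed
qed

text \<open>For \<open>A\<close> inside the vertex set: \<open>A\<close> is a union of components of
  the graph without \<open>X\<close>.\<close>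

definition separates :: "'a set set \<Rightarrow> 'a set \<Rightarrow> 'a set \<Rightarrow> bool" where
  "separates E A X \<longleftrightarrow> A \<inter> X = {} \<and> (\<forall>a b. {a, b} \<in> E \<longrightarrow> a \<in> A \<longrightarrow> b \<in> A \<union> X)"

text \<open>Call a set of nodes big when its bags cover at least \<open>x\<close> vertices. At the
  node \<open>t\<close> obtained for this notion, the bag \<open>B t\<close> serves as
  \<open>X\<close>, and \<open>A\<close> consists of the vertices outside \<open>B t\<close> that
  lie in the bags of suitably many branches that are not big.\<close>

lemma treewidth_separator:
  assumes G: "simple_graph V E" and tw: "treewidth V E < k" and x: "x \<le> card V" "x > 0"
  shows "\<exists>A X. A \<subseteq> V \<and> X \<subseteq> V \<and> separates E A X \<and> card X \<le> k \<and> x \<le> card A + k \<and> card A < 2 * x"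
proof -
  obtain I :: "nat set" and F B where td: "tree_decomposition V E I F B"
    and w: "decomposition_width I B = treewidth V E"
    using treewidth_attained[OF G] by blast
  have tree: "is_tree I F" and V: "(\<Union>t\<in>I. B t) = V"
    and E: "\<And>e. e \<in> E \<Longrightarrow> \<exists>t\<in>I. e \<subseteq> B t"
    and conn: "\<And>v. v \<in> V \<Longrightarrow> connected_graph {t \<in> I. v \<in> B t} F"
    using td by (auto simp: tree_decomposition_def)
  have finI: "finite I" using tree by (auto simp: is_tree_def simple_graph_def)
  have finV: "finite V" using G by (simp add: simple_graph_def)
  \<comment> \<open>The width is the largest bag size minus 1, so width less than \<open>k\<close>
    permits bags of \<open>k\<close> vertices.\<close>
  have cB: "card (B t) \<le> k" if "t \<in> I" for t
  proof -
    have "card (B t) \<le> Max ((\<lambda>t. card (B t)) ` I)" using that finI by simp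
    then show ?thesis using w tw by (simp add: decomposition_width_def)
  qed
  define big where "big = (\<lambda>K. x \<le> card (\<Union>p\<in>K. B p))"
  have "big I" using x(1) V by (simp add: big_def)
  from tree_node_with_small_components[where big = big, OF tree this]
  obtain t where t: "t \<in> I" and "\<exists>Q \<subseteq> I - {t}. (\<forall>q\<in>Q. \<not> big (comp_of I F t q)) \<and>
      big (insert t (\<Union>q\<in>Q. comp_of I F t q))" ..
  then obtain Q where Q: "Q \<subseteq> I - {t}" and small0: "\<forall>q\<in>Q. \<not> big (comp_of I F t q)"
    and big: "big (insert t (\<Union>q\<in>Q. comp_of I F t q))"
    by (elim exE conjE)
  note small = bspec[OF small0]
  let ?f = "\<lambda>q. (\<Union>p\<in>comp_of I F t q. B p) - B t"
  have cI: "comp_of I F t q \<subseteq> I - {t}" if "q \<in> Q" for q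
    using comp_of_subset[of q I t F] that Q by auto
  have fV: "(\<Union>p\<in>comp_of I F t q. B p) \<subseteq> V" if "q \<in> Q" for q
    using cI[OF that] V by fast
  have fin: "finite (\<Union>p\<in>comp_of I F t q. B p)" if "q \<in> Q" for q
    using fV[OF that] finV finite_subset by blast
  have f: "finite (?f q) \<and> card (?f q) < x" if "q \<in> Q" for q
    using fin[OF that] small[OF that, unfolded big_def] card_mono[OF fin[OF that], of "?f q"] by auto
  have "x \<le> card (\<Union>q\<in>Q. ?f q) + k"
  proof -
    have "(\<Union>p\<in>insert t (\<Union>q\<in>Q. comp_of I F t q). B p) = (\<Union>q\<in>Q. ?f q) \<union> B t" by auto
    then have "x \<le> card (\<Union>q\<in>Q. ?f q) + card (B t)" using big[unfolded big_def] card_Un_le by (metis order_trans)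
    then show ?thesis using cB[OF t] by linarith
  qed
  \<comment> \<open>The target \<open>x - k\<close> may truncate to 0; in either case the upper
    bound \<open>x - k + x\<close> is at most \<open>2 * x\<close>.\<close>
  then have "x - k \<le> card (\<Union>q\<in>Q. ?f q)" by simp
  moreover have "finite Q" using Q finI finite_subset by blast
  ultimately obtain Q' where Q': "Q' \<subseteq> Q" "x - k \<le> card (\<Union>q\<in>Q'. ?f q)"
      "card (\<Union>q\<in>Q'. ?f q) < x - k + x"
    using subfamily_with_card_between[of Q ?f x "x - k"] f x(2) by blast
  define A where "A = (\<Union>q\<in>Q'. ?f q)"
  \<comment> \<open>The nodes whose bags contain \<open>a\<close> are connected and avoid
    \<open>t\<close>, so a bag containing the edge belongs to the same branch.\<close>
  have "b \<in> A \<union> B t" if e: "{a, b} \<in> E" and a: "a \<in> A" for a b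
  proof -
    obtain q p where q: "q \<in> Q'" "p \<in> comp_of I F t q" "a \<in> B p" and at: "a \<notin> B t"
      using a by (auto simp: A_def)
    obtain r where r: "r \<in> I" "{a, b} \<subseteq> B r" using E[OF e] by blast
    have pI: "p \<in> I" using q Q'(1) cI by blast
    have "a \<in> V" using V r by blast
    then have "(adj_in {t \<in> I. a \<in> B t} F)\<^sup>*\<^sup>* p r"
      using conn[of a] q r pI by (auto simp: connected_graph_adj_in)
    then have "(adj_in (I - {t}) F)\<^sup>*\<^sup>* p r"
      by (rule adj_in_rtranclp_mono) (use at in auto)
    then have "r \<in> comp_of I F t q" using q(2) by (auto simp: comp_of_def)
    then show ?thesis using q(1) r by (auto simp: A_def)
  qed
  then have "separates E A (B t)" by (auto simp: separates_def A_def)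
  moreover have "A \<subseteq> V" using fV Q'(1) by (auto simp: A_def)
  moreover have "B t \<subseteq> V" using V t by blast
  ultimately show ?thesis using cB[OF t] Q' x(2) unfolding A_def[symmetric]
    by (intro exI[of _ A] exI[of _ "B t"]) auto
qed

section \<open>Sizes of sets with small boundary in binary trees\<close>

text \<open>The \<open>K\<close>-fold sumset; if \<open>0 \<in> D\<close>, it also contains all sums
  of fewer terms.\<close>

primrec sums_of :: "int set \<Rightarrow> nat \<Rightarrow> int set" where
  "sums_of D 0 = {0}"
| "sums_of D (Suc K) = (\<lambda>(a, b). a + b) ` (sums_of D K \<times> D)"

lemma finite_sums_of: "finite D \<Longrightarrow> finite (sums_of D K)"
  by (induction K) auto

lemma card_sums_of: "finite D \<Longrightarrow> card (sums_of D K) \<le> card D ^ K"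
proof (induction K)
  case (Suc K)
  have "card (sums_of D (Suc K)) \<le> card (sums_of D K \<times> D)"
    unfolding sums_of.simps using Suc(2) finite_sums_of by (intro card_image_le) auto
  also have "\<dots> \<le> card D ^ Suc K" using Suc by (simp add: card_cartesian_product)
  finally show ?case .
qed simp

lemma sum_in_sums_of:
  assumes "finite Z" "\<And>z. z \<in> Z \<Longrightarrow> f z \<in> D" "0 \<in> D" "card Z \<le> K"
  shows "sum f Z \<in> sums_of D K"
  using assms
proof (induction K arbitrary: Z)
  case 0
  then show ?case by simp
next
  case (Suc K)
  show ?case
  proof (cases "Z = {}")
    case True
    then have "sum f Z \<in> sums_of D K" using Suc.IH[of "{}"] Suc.prems by simp
    then show ?thesis using Suc.prems True by force
  next
    case False
    then obtain z where z: "z \<in> Z" by blast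
    have "sum f (Z - {z}) \<in> sums_of D K"
      using Suc.prems z by (intro Suc.IH) auto
    moreover have "sum f Z = sum f (Z - {z}) + f z"
      using z Suc.prems(1) by (simp add: sum.remove)
    ultimately show ?thesis using Suc.prems(2)[OF z] by force
  qed
qed

text \<open>\<open>2 ^ i - 1\<close> is the size of a complete binary tree with \<open>i\<close>
  levels; \<open>i = 0\<close> supplies the 0 that pads shorter sums.\<close>

definition signed_tree_sizes :: "nat \<Rightarrow> int set" where
  "signed_tree_sizes h = (\<lambda>i. 2 ^ i - 1) ` {..h} \<union> (\<lambda>i. - (2 ^ i - 1)) ` {..h}"

lemma finite_signed_tree_sizes: "finite (signed_tree_sizes h)"
  by (simp add: signed_tree_sizes_def)

lemma card_signed_tree_sizes: "card (signed_tree_sizes h) \<le> 2 * h + 2"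
proof -
  have "card (signed_tree_sizes h) \<le> card ((\<lambda>i. 2 ^ i - 1 :: int) ` {..h}) + card ((\<lambda>i. - (2 ^ i - 1) :: int) ` {..h})"
    unfolding signed_tree_sizes_def by (rule card_Un_le)
  also have "\<dots> \<le> card {..h} + card {..h}" by (intro add_mono card_image_le) auto
  finally show ?thesis by simp
qed

text \<open>
  Node \<open>v\<close> of the complete binary tree on \<open>{1..<2 ^ h}\<close> has parent \<open>v div 2\<close>, so
  \<open>heap_size h v\<close> is the number of its descendants, itself included.
\<close>

definition heap_size :: "nat \<Rightarrow> nat \<Rightarrow> int" where
  "heap_size h v = 2 ^ (Suc h - floorlog 2 v) - 1"

text \<open>\<open>floorlog 2 v\<close> is the level of \<open>v\<close>, the root having level 1. A
  subtree with \<open>i + 1\<close> levels is its root and two subtrees with \<open>i\<close>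
  levels; leaves are the case \<open>i = 0\<close>.\<close>

lemma heap_size_eq:
  assumes "v \<in> {1..<2 ^ h}"
  shows "heap_size h v = 1 + heap_size h (2 * v) + heap_size h (2 * v + 1)"
proof -
  have 1: "floorlog 2 (2 * v) = Suc (floorlog 2 v)" "floorlog 2 (2 * v + 1) = Suc (floorlog 2 v)"
    using assms compute_floorlog[of 2 "2 * v"] compute_floorlog[of 2 "2 * v + 1"] by auto
  have "floorlog 2 v \<le> h" using assms by (intro floorlog_leI) auto
  then show ?thesis unfolding heap_size_def 1 by (simp add: Suc_diff_le)
qed

lemma heap_size_outside: "2 ^ h \<le> v \<Longrightarrow> heap_size h v = 0"
  using floorlog_ge_SucI[of 2 h v] by (simp add: heap_size_def)

lemma heap_size_signed:
  assumes "v > 0"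
  shows "heap_size h v \<in> signed_tree_sizes h" "- heap_size h v \<in> signed_tree_sizes h"
proof -
  have "floorlog 2 v > 0" using assms floorlog_eq_zero_iff[of 2 v] by simp
  then show "heap_size h v \<in> signed_tree_sizes h" "- heap_size h v \<in> signed_tree_sizes h"
    by (auto simp: heap_size_def signed_tree_sizes_def image_iff intro!: bexI[of _ "Suc h - floorlog 2 v"])
qed

lemma sum_children_heap_size:
  assumes "A \<subseteq> {1..<2 ^ h}"
  shows "(\<Sum>v\<in>{v \<in> {2..<2 ^ h}. v div 2 \<in> A}. heap_size h v)
    = (\<Sum>v\<in>A. heap_size h (2 * v) + heap_size h (2 * v + 1))"
proof -
  have fin: "finite A" using assms finite_subset by blast
  have "(\<Sum>v\<in>{v \<in> {2..<2 ^ h}. v div 2 \<in> A}. heap_size h v)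
      = (\<Sum>v\<in>(\<lambda>v. 2 * v) ` A \<union> (\<lambda>v. 2 * v + 1) ` A. heap_size h v)"
  proof (rule sum.mono_neutral_left)
    show "finite ((\<lambda>v. 2 * v) ` A \<union> (\<lambda>v. 2 * v + 1) ` A)" using fin by simp
    show "{v \<in> {2..<2 ^ h}. v div 2 \<in> A} \<subseteq> (\<lambda>v. 2 * v) ` A \<union> (\<lambda>v. 2 * v + 1) ` A"
    proof
      fix v assume "v \<in> {v \<in> {2..<2 ^ h}. v div 2 \<in> A}"
      moreover have "v = 2 * (v div 2) \<or> v = 2 * (v div 2) + 1" by presburger
      ultimately show "v \<in> (\<lambda>v. 2 * v) ` A \<union> (\<lambda>v. 2 * v + 1) ` A" by blast
    qed
    \<comment> \<open>The surplus numbers are at least \<open>2 ^ h\<close>, hence outside the tree,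
      where \<open>heap_size\<close> vanishes.\<close>
    show "\<forall>v\<in>(\<lambda>v. 2 * v) ` A \<union> (\<lambda>v. 2 * v + 1) ` A - {v \<in> {2..<2 ^ h}. v div 2 \<in> A}. heap_size h v = 0"
    proof
      fix v assume v: "v \<in> (\<lambda>v. 2 * v) ` A \<union> (\<lambda>v. 2 * v + 1) ` A - {v \<in> {2..<2 ^ h}. v div 2 \<in> A}"
      then have "v \<ge> 2" "v div 2 \<in> A" using assms by fastforce+
      then show "heap_size h v = 0" using v by (intro heap_size_outside) auto
    qed
  qed
  also have "\<dots> = (\<Sum>v\<in>(\<lambda>v. 2 * v) ` A. heap_size h v) + (\<Sum>v\<in>(\<lambda>v. 2 * v + 1) ` A. heap_size h v)"
  proof (rule sum.union_disjoint)
    show "(\<lambda>v. 2 * v) ` A \<inter> (\<lambda>v. 2 * v + 1) ` A = {}"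
      by auto presburger
  qed (use fin in auto)
  also have "\<dots> = (\<Sum>v\<in>A. heap_size h (2 * v)) + (\<Sum>v\<in>A. heap_size h (2 * v + 1))"
    by (subst (1 2) sum.reindex) (auto simp: inj_on_def)
  finally show ?thesis by (simp add: sum.distrib)
qed

text \<open>
  Adding up \<open>1 = heap_size h v - heap_size h (2 * v) - heap_size h (2 * v + 1)\<close> over \<open>A\<close>, every
  node contributes unless it and its parent are on the same side of \<open>A\<close>.
\<close>

lemma card_eq_sum_heap_size:
  assumes "A \<subseteq> {1..<2 ^ h}"
  shows "int (card A) = (\<Sum>v\<in>{1..<2 ^ h}. (of_bool (v \<in> A) - of_bool (v \<ge> 2 \<and> v div 2 \<in> A)) * heap_size h v)"
proof -
  have "(\<Sum>v\<in>{1..<2 ^ h}. (of_bool (v \<in> A) - of_bool (v \<ge> 2 \<and> v div 2 \<in> A)) * heap_size h v)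
    = (\<Sum>v\<in>{1..<2 ^ h}. of_bool (v \<in> A) * heap_size h v)
      - (\<Sum>v\<in>{1..<2 ^ h}. of_bool (v \<ge> 2 \<and> v div 2 \<in> A) * heap_size h v)"
    by (simp add: left_diff_distrib sum_subtractf)
  also have "(\<Sum>v\<in>{1..<2 ^ h}. of_bool (v \<in> A) * heap_size h v) = (\<Sum>v\<in>A. heap_size h v)"
    by (rule sum.mono_neutral_cong_right) (use assms in auto)
  also have "(\<Sum>v\<in>{1..<2 ^ h}. of_bool (v \<ge> 2 \<and> v div 2 \<in> A) * heap_size h v)
      = (\<Sum>v\<in>{v \<in> {2..<2 ^ h}. v div 2 \<in> A}. heap_size h v)"
    by (rule sum.mono_neutral_cong_right) auto
  also have "\<dots> = (\<Sum>v\<in>A. heap_size h (2 * v) + heap_size h (2 * v + 1))"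
    using sum_children_heap_size[OF assms] .
  also have "(\<Sum>v\<in>A. heap_size h v) - \<dots> = (\<Sum>v\<in>A. 1)"
    unfolding sum_subtractf[symmetric]
    by (rule sum.cong) (use assms heap_size_eq in fastforce)+
  finally show ?thesis by simp
qed

text \<open>Apply \<open>card_eq_sum_heap_size\<close> in every copy. A nonzero term below a root
  has node and parent on different sides of \<open>A\<close>, so one of the two is in
  \<open>X\<close>. A nonzero term at a root puts the root in \<open>A\<close>; if its copy
  contained no element of \<open>X\<close>, all \<open>2 ^ h - 1\<close> nodes of the copy would be
  in \<open>A\<close>.\<close>

lemma separated_heaps_card:
  fixes h R :: nat
  defines "P \<equiv> {..<R} \<times> {1..<(2::nat) ^ h}"
  assumes sub: "A \<subseteq> P" "X \<subseteq> P"
    and down: "\<And>c v. (c, v) \<in> P \<Longrightarrow> v \<ge> 2 \<Longrightarrow> (c, v div 2) \<in> A \<Longrightarrow> (c, v) \<in> A \<union> X"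
    and up: "\<And>c v. (c, v) \<in> P \<Longrightarrow> v \<ge> 2 \<Longrightarrow> (c, v) \<in> A \<Longrightarrow> (c, v div 2) \<in> A \<union> X"
    and small: "card A < 2 ^ h - 1" and k: "card X \<le> k"
  shows "int (card A) \<in> sums_of (signed_tree_sizes h) (4 * k)"
proof -
  define f where "f = (\<lambda>(c, v). (of_bool ((c, v) \<in> A) - of_bool (v \<ge> 2 \<and> (c, v div 2) \<in> A)) * heap_size h v)"
  define Z where "Z = {p \<in> P. f p \<noteq> 0}"
  have finP: "finite P" by (simp add: P_def)
  have finA: "finite A" and finX: "finite X" using sub finP finite_subset by blast+
  have "int (card A) = sum f P"
  proof -
    have "A = (\<Union>c\<in>{..<R}. Pair c ` {v. (c, v) \<in> A})" using sub by (auto simp: P_def)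
    then have "card A = (\<Sum>c<R. card (Pair c ` {v. (c, v) \<in> A}))"
      by (subst card_UN_disjoint[symmetric]) (auto intro: finite_subset[OF _ finA])
    also have "\<dots> = (\<Sum>c<R. card {v. (c, v) \<in> A})"
      by (intro sum.cong card_image) (auto simp: inj_on_def)
    finally have "int (card A) = (\<Sum>c<R. int (card {v. (c, v) \<in> A}))" by simp
    also have "\<dots> = (\<Sum>c<R. \<Sum>v\<in>{1..<2 ^ h}. f (c, v))"
    proof (rule sum.cong)
      fix c
      have "{v. (c, v) \<in> A} \<subseteq> {1..<2 ^ h}" using sub by (auto simp: P_def)
      from card_eq_sum_heap_size[OF this]
      show "int (card {v. (c, v) \<in> A}) = (\<Sum>v\<in>{1..<2 ^ h}. f (c, v))" by (simp add: f_def)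
    qed simp
    also have "\<dots> = sum f P" by (simp add: P_def sum.cartesian_product)
    finally show ?thesis .
  qed
  also have "\<dots> = sum f Z" by (rule sum.mono_neutral_right) (use finP in \<open>auto simp: Z_def\<close>)
  finally have eq: "int (card A) = sum f Z" .
  \<comment> \<open>An element of \<open>X\<close> accounts for at most four terms: its own, those
    of its two children and that of the root of its copy. Hence the bound
    \<open>4 * k\<close>.\<close>
  let ?Y = "X \<union> (\<lambda>(c, v). (c, 2 * v)) ` X \<union> (\<lambda>(c, v). (c, 2 * v + 1)) ` X \<union> (\<lambda>(c, v). (c, 1)) ` X"
  have "Z \<subseteq> ?Y"
  proof
    fix p assume p: "p \<in> Z"
    obtain c v where cv: "p = (c, v)" by force
    have inP: "(c, v) \<in> P" and nz: "f (c, v) \<noteq> 0" using p cv by (auto simp: Z_def)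
    show "p \<in> ?Y"
    proof (cases "v \<ge> 2")
      case True
      have "(c, v) \<in> A \<longleftrightarrow> (c, v div 2) \<notin> A" using nz True by (auto simp: f_def split: if_splits)
      then have "(c, v) \<in> X \<or> (c, v div 2) \<in> X" using down[OF inP True] up[OF inP True] by blast
      moreover have "v = 2 * (v div 2) \<or> v = 2 * (v div 2) + 1" by presburger
      ultimately show ?thesis unfolding cv by force
    next
      case False
      then have v: "v = 1" using inP by (auto simp: P_def)
      have cA: "(c, 1) \<in> A" using nz False by (auto simp: f_def v split: if_splits)
      have "\<exists>w. (c, w) \<in> X"
      proof (rule ccontr)
        assume no: "\<nexists>w. (c, w) \<in> X"
        have "(c, w) \<in> A" if "w \<in> {1..<2 ^ h}" for w
          using that
        proof (induction w rule: less_induct)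
          case (less w)
          show ?case
          proof (cases "w \<ge> 2")
            case True
            have "(c, w div 2) \<in> A" using less True by (intro less.IH) auto
            moreover have "(c, w) \<in> P" using less inP by (auto simp: P_def)
            ultimately show ?thesis using down True no by blast
          next
            case False
            then have "w = 1" using less by auto
            then show ?thesis using cA by simp
          qed
        qed
        then have "Pair c ` {1..<2 ^ h} \<subseteq> A" by blast
        then have "card (Pair c ` {1..<2 ^ h :: nat}) \<le> card A" using finA card_mono by blast
        then show False using small by (simp add: card_image inj_on_def)
      qed
      then show ?thesis unfolding cv v by force
    qed
  qed
  then have "card Z \<le> card ?Y" using finX by (intro card_mono) auto
  also have "\<dots> \<le> card X + card X + card X + card X"
    using finX by (intro order_trans[OF card_Un_le] add_mono card_image_le) auto
  finally have "card Z \<le> 4 * k" using k by simp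
  moreover have "f z \<in> signed_tree_sizes h" if "z \<in> Z" for z
  proof -
    obtain c v where z: "z = (c, v)" by force
    have "v > 0" using that by (auto simp: z Z_def P_def)
    then show ?thesis using that heap_size_signed[of v h]
      by (cases "(c, v) \<in> A"; cases "v \<ge> 2 \<and> (c, v div 2) \<in> A") (auto simp: z f_def Z_def)
  qed
  moreover have "(0 :: int) \<in> signed_tree_sizes h"
    by (auto simp: signed_tree_sizes_def image_iff intro!: bexI[of _ 0])
  moreover have "finite Z" using finP by (simp add: Z_def)
  ultimately show ?thesis unfolding eq by (intro sum_in_sums_of) auto
qed

section \<open>Trees given by parent functions\<close>

text \<open>Following parents leads to 1, which gives connectedness. The largest vertex of a cycle
  would have two distinct smaller neighbours, but its only smaller neighbour is its parent.\<close>

lemma parent_function_is_tree: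
  fixes p :: "nat \<Rightarrow> nat"
  assumes n: "n \<ge> 1" and p: "\<And>w. w \<in> {2..n} \<Longrightarrow> p w \<in> {1..<w}"
  shows "is_tree {1..n} ((\<lambda>w. {p w, w}) ` {2..n})" (is "is_tree ?V ?E")
  unfolding is_tree_def
proof (intro conjI)
  have "{p w, w} \<subseteq> ?V \<and> card {p w, w} = 2" if "w \<in> {2..n}" for w
    using p[OF that] that by (auto simp: card_2_iff)
  then show "simple_graph ?V ?E" by (auto simp: simple_graph_def)
  have root: "(adj_in ?V ?E)\<^sup>*\<^sup>* w 1" if "w \<in> ?V" for w
    using that
  proof (induction w rule: less_induct)
    case (less w)
    show ?case
    proof (cases "w = 1")
      case False
      then have w: "w \<in> {2..n}" using less by auto
      then have "adj_in ?V ?E w (p w)"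
        using p[OF w] by (auto simp: adj_in_def insert_commute)
      moreover have "(adj_in ?V ?E)\<^sup>*\<^sup>* (p w) 1" using p[OF w] w by (intro less.IH) auto
      ultimately show ?thesis by (rule converse_rtranclp_into_rtranclp)
    qed simp
  qed
  show "connected_graph ?V ?E"
    unfolding connected_graph_adj_in
  proof (intro conjI ballI)
    show "(adj_in ?V ?E)\<^sup>*\<^sup>* u v" if "u \<in> ?V" "v \<in> ?V" for u v
      using root[OF that(1)] adj_in_rtranclp_sym[OF root[OF that(2)]] by (rule rtranclp_trans)
  qed (use n in auto)
  show "\<nexists>xs. is_cycle ?E xs"
  proof
    assume "\<exists>xs. is_cycle ?E xs"
    then obtain xs where len: "length xs \<ge> 3" and d: "distinct xs"
      and e: "\<And>i. i < length xs \<Longrightarrow> {xs ! i, xs ! (Suc i mod length xs)} \<in> ?E"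
      by (auto simp: is_cycle_def)
    define m where "m = Max (set xs)"
    have "set xs \<noteq> {}" using len by auto
    then have "m \<in> set xs" by (simp add: m_def)
    then obtain i where i: "i < length xs" "xs ! i = m" by (auto simp: in_set_conv_nth)
    have parent: "xs ! j = p m" if "j < length xs" "{xs ! j, m} \<in> ?E" for j
    proof -
      have "xs ! j \<le> m" using that by (simp add: m_def)
      with that(2) p show ?thesis by (fastforce simp: doubleton_eq_iff)
    qed
    \<comment> \<open>\<open>j\<close> and \<open>j'\<close> are the cyclic predecessor and
      successor of \<open>i\<close>; they differ because the length is at least 3.\<close>
    define j where "j = (if i = 0 then length xs - 1 else i - 1)"
    define j' where "j' = Suc i mod length xs"
    have j: "j < length xs" "Suc j mod length xs = i"
      using i len by (auto simp: j_def)
    have j': "j' < length xs" unfolding j'_def using len by (intro mod_less_divisor) linarith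
    have "j \<noteq> j'" using i len by (auto simp: j_def j'_def mod_Suc split: if_splits)
    moreover have "xs ! j = p m" using parent[OF j(1)] e[OF j(1)] i(2) j(2) by simp
    moreover have "xs ! j' = p m"
      using parent[OF j'] e[OF i(1)] i(2) by (simp add: j'_def insert_commute)
    ultimately show False using nth_eq_iff_index_eq[OF d j(1) j'] by simp
  qed
qed

section \<open>Sets with small boundary in blown-up binary trees\<close>

lemma separates_edge_iff:
  assumes "separates E A X" "{a, b} \<in> E" "a \<notin> X" "b \<notin> X"
  shows "a \<in> A \<longleftrightarrow> b \<in> A"
proof -
  have "{b, a} \<in> E" using assms(2) by (simp add: insert_commute)
  then show ?thesis using assms unfolding separates_def by blast
qed

text \<open>Contract each cell to a node. Cells inside \<open>A\<close> that avoid \<open>X\<close>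
  form \<open>A'\<close>, cells meeting \<open>X\<close> form \<open>X'\<close>, and all others are
  disjoint from \<open>A\<close>. Then \<open>separated_heaps_card\<close> applies to
  \<open>A'\<close> and \<open>X'\<close>, and \<open>u = card A'\<close>. The error term comes from
  the at most \<open>k\<close> cells in \<open>X'\<close>, of \<open>\<theta>\<close> vertices
  each.\<close>

lemma separated_blowup_card:
  fixes h R \<theta> k :: nat and cell_of :: "'a \<Rightarrow> nat \<times> nat" and V :: "'a set"
  defines "P \<equiv> {..<R} \<times> {1..<(2::nat) ^ h}"
    and "cell \<equiv> \<lambda>p. {w \<in> V. cell_of w = p}"
  assumes fin: "finite V" and cov: "cell_of ` V \<subseteq> P" and \<theta>: "\<theta> > 0"
    and card_cell: "\<And>p. p \<in> P \<Longrightarrow> card (cell p) = \<theta>"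
    and link: "\<And>c v. (c, v) \<in> P \<Longrightarrow> v \<ge> 2 \<Longrightarrow> \<exists>a\<in>cell (c, v). \<exists>b\<in>cell (c, v div 2). {a, b} \<in> E"
    and AX: "A \<subseteq> V" "X \<subseteq> V" "separates E A X"
    and mono: "\<And>p. p \<in> P \<Longrightarrow> cell p \<inter> X = {} \<Longrightarrow> cell p \<subseteq> A \<or> cell p \<inter> A = {}"
    and small: "card A < 2 ^ h - 1" and k: "card X \<le> k"
  shows "\<exists>u\<in>sums_of (signed_tree_sizes h) (4 * k).
    int \<theta> * u \<le> int (card A) \<and> int (card A) \<le> int \<theta> * (u + int k)"
proof -
  define A' where "A' = {p \<in> P. cell p \<inter> X = {} \<and> cell p \<subseteq> A}"
  define X' where "X' = {p \<in> P. cell p \<inter> X \<noteq> {}}"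
  have fins: "finite A" "finite X" using AX fin finite_subset by blast+
  have finc: "finite (cell p)" for p using fin by (simp add: cell_def)
  have finP: "finite P" by (simp add: P_def)
  have finA': "finite A'" and finX': "finite X'" using finP by (simp_all add: A'_def X'_def)
  have "X' \<subseteq> cell_of ` X"
  proof
    fix p assume "p \<in> X'"
    then obtain w where "w \<in> cell p" "w \<in> X" unfolding X'_def by blast
    then show "p \<in> cell_of ` X" unfolding cell_def by blast
  qed
  then have cX': "card X' \<le> k" using fins(2) k surj_card_le order_trans by blast
  have crossing: "q \<in> A' \<union> X'" if "p \<in> A'" "q \<in> P" "a \<in> cell p" "b \<in> cell q" "{a, b} \<in> E" for p q a b
  proof -
    have "a \<in> A" using that by (auto simp: A'_def)
    then have "b \<in> A \<union> X" using AX(3) that(5) by (auto simp: separates_def)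
    then show ?thesis using that mono[OF that(2)] by (auto simp: A'_def X'_def)
  qed
  have half: "(c, v div 2) \<in> P" if "(c, v) \<in> P" "v \<ge> 2" for c v
    using that by (auto simp: P_def)
  have sumsA': "\<Union> (cell ` A') \<subseteq> A" by (auto simp: A'_def)
  have cU: "card (\<Union> (cell ` Q)) = \<theta> * card Q" if "Q \<subseteq> P" for Q
  proof -
    have "finite Q" using that finP finite_subset by blast
    then have "card (\<Union> (cell ` Q)) = (\<Sum>p\<in>Q. card (cell p))"
      by (intro card_UN_disjoint) (auto simp: finc, auto simp: cell_def)
    also have "\<dots> = (\<Sum>p\<in>Q. \<theta>)" using card_cell that by (intro sum.cong) auto
    finally show ?thesis by simp
  qed
  have cA': "card (\<Union> (cell ` A')) = \<theta> * card A'" by (rule cU) (auto simp: A'_def)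
  then have lower: "\<theta> * card A' \<le> card A" using sumsA' fins(1) card_mono by metis
  have "A \<subseteq> \<Union> (cell ` A') \<union> \<Union> (cell ` X')"
  proof
    fix a assume a: "a \<in> A"
    let ?p = "cell_of a"
    have "a \<in> cell ?p" "?p \<in> P" using a AX(1) cov by (auto simp: cell_def)
    moreover have "?p \<in> A' \<union> X'"
      using calculation a mono[of ?p] unfolding A'_def X'_def
      by (cases "cell ?p \<inter> X = {}") (simp, blast, simp)
    ultimately show "a \<in> \<Union> (cell ` A') \<union> \<Union> (cell ` X')" by blast
  qed
  then have "card A \<le> card (\<Union> (cell ` A') \<union> \<Union> (cell ` X'))"
    using finA' finX' finc by (intro card_mono) auto
  also have "\<dots> \<le> \<theta> * card A' + \<theta> * card X'"
    using card_Un_le[of "\<Union> (cell ` A')" "\<Union> (cell ` X')"] cA' cU[of X'] by (auto simp: X'_def)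
  also have "\<dots> \<le> \<theta> * (card A' + k)" using cX' by (simp add: distrib_left)
  finally have upper: "card A \<le> \<theta> * (card A' + k)" .
  have "int (card A') \<in> sums_of (signed_tree_sizes h) (4 * k)"
  proof (rule separated_heaps_card[of A' R h X'])
    show "A' \<subseteq> {..<R} \<times> {1..<2 ^ h}" "X' \<subseteq> {..<R} \<times> {1..<2 ^ h}"
      by (auto simp: A'_def X'_def P_def)
    have "card A' \<le> \<theta> * card A'" using \<theta> by simp
    then show "card A' < 2 ^ h - 1" using lower small by linarith
    fix c v :: nat assume v: "(c, v) \<in> {..<R} \<times> {1..<2 ^ h}" "v \<ge> 2"
    then have P: "(c, v) \<in> P" by (simp add: P_def)
    obtain a b where ab: "a \<in> cell (c, v)" "b \<in> cell (c, v div 2)" "{a, b} \<in> E"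
      using link[OF P v(2)] by blast
    show "(c, v) \<in> A' \<union> X'" if "(c, v div 2) \<in> A'"
      using crossing[OF that P ab(2,1)] ab(3) by (simp add: insert_commute)
    show "(c, v div 2) \<in> A' \<union> X'" if "(c, v) \<in> A'"
      using crossing[OF that half[OF P v(2)] ab] .
  qed (rule cX')
  moreover have "int \<theta> * int (card A') \<le> int (card A)"
    using lower by (metis of_nat_le_iff of_nat_mult)
  moreover have "int (card A) \<le> int \<theta> * (int (card A') + int k)"
    using upper by (metis of_nat_le_iff of_nat_mult of_nat_add)
  ultimately show ?thesis by blast
qed

text \<open>
  Copies of the complete binary tree on \<open>{1..<2 ^ h}\<close>, each node replaced by a path of \<open>\<theta>\<close>
  vertices. Vertices are numbered from 1, path by path and copy by copy; \<open>cell_index\<close> gives the copy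
  and the node of a vertex. The edges between consecutive copies only serve to connect them.
\<close>

definition cell_index :: "nat \<Rightarrow> nat \<Rightarrow> nat \<Rightarrow> nat \<times> nat" where
  "cell_index h \<theta> w = ((w - 1) div \<theta> div (2 ^ h - 1), (w - 1) div \<theta> mod (2 ^ h - 1) + 1)"

text \<open>The first vertex of a path hangs from the first vertex of the parent node's path. All
  other vertices hang from \<open>w - 1\<close>, which is a path edge or, at the root of a later
  copy, the link to the copy before. So parents are smaller, as
  \<open>parent_function_is_tree\<close> requires.\<close>

definition blowup_parent :: "nat \<Rightarrow> nat \<Rightarrow> nat \<Rightarrow> nat" where
  "blowup_parent h \<theta> w = (case cell_index h \<theta> w of (c, v) \<Rightarrow>
     if \<theta> dvd w - 1 \<and> v > 1 then 1 + \<theta> * ((2 ^ h - 1) * c + (v div 2 - 1)) else w - 1)"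

definition blowup_edges :: "nat \<Rightarrow> nat \<Rightarrow> nat \<Rightarrow> nat set set" where
  "blowup_edges h \<theta> n = (\<lambda>w. {blowup_parent h \<theta> w, w}) ` {2..n}"

lemma cell_index_eq:
  assumes "\<theta> > 0" "j < \<theta>" "v \<in> {1..<2 ^ h}"
  shows "cell_index h \<theta> (1 + \<theta> * ((2 ^ h - 1) * c + (v - 1)) + j) = (c, v)"
proof -
  have d: "(1 + \<theta> * ((2 ^ h - 1) * c + (v - 1)) + j - 1) div \<theta> = (2 ^ h - 1) * c + (v - 1)"
    using assms by (simp add: div_mult_self4)
  have "v - 1 < 2 ^ h - 1" using assms by auto
  then have q: "((2 ^ h - 1) * c + (v - 1)) div (2 ^ h - 1) = c"
      "((2 ^ h - 1) * c + (v - 1)) mod (2 ^ h - 1) = v - 1"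
    by (simp_all only: div_mult_self4 mod_mult_self4 div_less mod_less)
  show ?thesis unfolding cell_index_def d q using assms(3) by simp
qed

lemma cell_eq_interval:
  assumes "\<theta> > 0" "c < R" "v \<in> {1..<2 ^ h}"
  shows "{w \<in> {1..R * (2 ^ h - 1) * \<theta>}. cell_index h \<theta> w = (c, v)}
    = {1 + \<theta> * ((2 ^ h - 1) * c + (v - 1)) ..< 1 + \<theta> * ((2 ^ h - 1) * c + (v - 1)) + \<theta>}"
    (is "?L = {?s ..< ?s + \<theta>}")
proof (intro equalityI subsetI)
  fix w assume "w \<in> ?L"
  then have w: "w \<ge> 1" and c: "(w - 1) div \<theta> div (2 ^ h - 1) = c" and v: "(w - 1) div \<theta> mod (2 ^ h - 1) = v - 1"
    by (auto simp: cell_index_def)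
  have "(w - 1) div \<theta> = (2 ^ h - 1) * c + (v - 1)"
    using c v mult_div_mod_eq[of "2 ^ h - 1" "(w - 1) div \<theta>"] by simp
  then have "w - 1 = \<theta> * ((2 ^ h - 1) * c + (v - 1)) + (w - 1) mod \<theta>"
    using mult_div_mod_eq[of \<theta> "w - 1"] by simp
  moreover have "(w - 1) mod \<theta> < \<theta>" using assms(1) by simp
  ultimately show "w \<in> {?s ..< ?s + \<theta>}" using w by auto
next
  fix w assume w: "w \<in> {?s ..< ?s + \<theta>}"
  then have "w = ?s + (w - ?s)" "w - ?s < \<theta>" by auto
  then have "cell_index h \<theta> w = (c, v)" using cell_index_eq[OF assms(1) _ assms(3), of "w - ?s" c] by simp
  moreover have "w \<le> R * (2 ^ h - 1) * \<theta>"
  proof -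
    have "w \<le> \<theta> * ((2 ^ h - 1) * c + (v - 1) + 1)" using w by (simp add: algebra_simps)
    also have "\<dots> \<le> \<theta> * ((2 ^ h - 1) * c + (2 ^ h - 1))" using assms by (intro mult_left_mono add_left_mono) auto
    also have "\<dots> = \<theta> * ((2 ^ h - 1) * Suc c)" by (simp only: mult_Suc_right add.commute)
    also have "\<dots> \<le> \<theta> * ((2 ^ h - 1) * R)" using assms by (intro mult_left_mono) auto
    finally show ?thesis by (simp add: ac_simps)
  qed
  ultimately show "w \<in> ?L" using w by auto
qed

lemma blowup_is_tree:
  assumes "\<theta> > 0" "n \<ge> 1"
  shows "is_tree {1..n} (blowup_edges h \<theta> n)"
  unfolding blowup_edges_def
proof (rule parent_function_is_tree[OF assms(2)])
  fix w assume w: "w \<in> {2..n}"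
  obtain c v where cv: "cell_index h \<theta> w = (c, v)" by force
  show "blowup_parent h \<theta> w \<in> {1..<w}"
  proof (cases "\<theta> dvd w - 1 \<and> v > 1")
    case True
    have "(w - 1) div \<theta> = (2 ^ h - 1) * c + (v - 1)"
      using cv mult_div_mod_eq[of "2 ^ h - 1" "(w - 1) div \<theta>"] by (auto simp: cell_index_def)
    then have "w = 1 + \<theta> * ((2 ^ h - 1) * c + (v - 1))"
      using True w by (metis One_nat_def Suc_pred atLeastAtMost_iff dvd_mult_div_cancel not_gr_zero not_numeral_le_zero plus_1_eq_Suc)
    moreover have "v div 2 - 1 < v - 1" using True by auto
    then have "\<theta> * ((2 ^ h - 1) * c + (v div 2 - 1)) < \<theta> * ((2 ^ h - 1) * c + (v - 1))" using assms(1) by simp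
    ultimately have "1 + \<theta> * ((2 ^ h - 1) * c + (v div 2 - 1)) \<in> {1..<w}"
      unfolding atLeastLessThan_iff by linarith
    then show ?thesis using True unfolding blowup_parent_def cv by simp
  next
    case False
    then show ?thesis using w by (auto simp: blowup_parent_def cv)
  qed
qed

text \<open>A cell is a path, so if it avoids \<open>X\<close> it cannot leave \<open>A\<close>; the
  first vertices of cells provide the links. The first tree has \<open>\<theta>\<close> copies with
  paths of one vertex, the second one copy with paths of \<open>\<theta>\<close> vertices.\<close>

lemma separated_blowup_edges_card:
  fixes h R \<theta> k :: nat
  defines "n \<equiv> R * (2 ^ h - 1) * \<theta>"
  assumes \<theta>: "\<theta> > 0" and AX: "A \<subseteq> {1..n}" "X \<subseteq> {1..n}" "separates (blowup_edges h \<theta> n) A X"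
    and small: "card A < 2 ^ h - 1" and k: "card X \<le> k"
  shows "\<exists>u\<in>sums_of (signed_tree_sizes h) (4 * k).
    int \<theta> * u \<le> int (card A) \<and> int (card A) \<le> int \<theta> * (u + int k)"
proof (rule separated_blowup_card[where cell_of = "cell_index h \<theta>" and V = "{1..n}" and R = R])
  let ?first = "\<lambda>c v. 1 + \<theta> * ((2 ^ h - 1) * c + (v - 1))"
  let ?cell = "\<lambda>c v. {?first c v ..< ?first c v + \<theta>}"
  have cell: "{w \<in> {1..n}. cell_index h \<theta> w = (c, v)} = ?cell c v"
    if "(c, v) \<in> {..<R} \<times> {1..<2 ^ h}" for c v
    unfolding n_def using that \<theta> by (intro cell_eq_interval) auto
  have L: "(2::nat) ^ h - 1 > 0" using small by simp
  show "cell_index h \<theta> ` {1..n} \<subseteq> {..<R} \<times> {1..<2 ^ h}"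
  proof (rule image_subsetI)
    fix w assume "w \<in> {1..n}"
    then have "w - 1 < R * (2 ^ h - 1) * \<theta>" by (auto simp: n_def)
    then have "(w - 1) div \<theta> div (2 ^ h - 1) < R" by (simp add: less_mult_imp_div_less)
    moreover have "(w - 1) div \<theta> mod (2 ^ h - 1) < 2 ^ h - 1" using L by simp
    ultimately show "cell_index h \<theta> w \<in> {..<R} \<times> {1..<2 ^ h}" by (auto simp: cell_index_def)
  qed
  fix p assume "p \<in> {..<R} \<times> {1..<(2::nat) ^ h}"
  then obtain c v where p: "p = (c, v)" and P: "(c, v) \<in> {..<R} \<times> {1..<2 ^ h}" by (cases p) auto
  show "card {w \<in> {1..n}. cell_index h \<theta> w = p} = \<theta>" unfolding p cell[OF P] by simp
  have step: "{w, Suc w} \<in> blowup_edges h \<theta> n" if w: "?first c v \<le> w" "Suc w < ?first c v + \<theta>" for w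
  proof -
    have "Suc w \<in> ?cell c v" using w by simp
    then have "Suc w \<in> {1..n}" using cell[OF P] by blast
    moreover have "\<not> \<theta> dvd w"
    proof
      assume "\<theta> dvd w"
      then have "\<theta> dvd w - \<theta> * ((2 ^ h - 1) * c + (v - 1))" by (simp add: dvd_diff_nat)
      then show False using w by (auto dest!: dvd_imp_le)
    qed
    ultimately show ?thesis using w
      by (auto simp: blowup_edges_def blowup_parent_def image_iff split: prod.split intro!: bexI[of _ "Suc w"])
  qed
  assume dis: "{w \<in> {1..n}. cell_index h \<theta> w = p} \<inter> X = {}"
  then have dis': "?cell c v \<inter> X = {}" unfolding p cell[OF P] .
  have same: "?first c v + j \<in> A \<longleftrightarrow> ?first c v \<in> A" if "j < \<theta>" for j
    using that
  proof (induction j)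
    case (Suc j)
    let ?w = "?first c v + j"
    have e: "{?w, Suc ?w} \<in> blowup_edges h \<theta> n" using Suc.prems by (intro step) auto
    have "?w \<in> ?cell c v" "Suc ?w \<in> ?cell c v" using Suc.prems by auto
    then have "?w \<notin> X" "Suc ?w \<notin> X" using dis' by (meson disjoint_iff)+
    from separates_edge_iff[OF AX(3) e this] have "?w \<in> A \<longleftrightarrow> Suc ?w \<in> A" .
    then show ?case using Suc by simp
  qed simp
  have "w \<in> A \<longleftrightarrow> ?first c v \<in> A" if "w \<in> ?cell c v" for w
    using same[of "w - ?first c v"] that by auto
  then show "{w \<in> {1..n}. cell_index h \<theta> w = p} \<subseteq> A \<or> {w \<in> {1..n}. cell_index h \<theta> w = p} \<inter> A = {}"
    unfolding p cell[OF P] by blast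
next
  fix c v :: nat assume P: "(c, v) \<in> {..<R} \<times> {1..<2 ^ h}" and v: "v \<ge> 2"
  let ?first = "\<lambda>v. 1 + \<theta> * ((2 ^ h - 1) * c + (v - 1))"
  have mem: "?first u \<in> {w \<in> {1..n}. cell_index h \<theta> w = (c, u)}" if "u \<in> {1..<2 ^ h}" for u
    unfolding n_def using cell_eq_interval[OF \<theta>, of c R u h] that P \<theta> by auto
  have 1: "?first v \<in> {w \<in> {1..n}. cell_index h \<theta> w = (c, v)}" using P by (intro mem) auto
  have 2: "?first (v div 2) \<in> {w \<in> {1..n}. cell_index h \<theta> w = (c, v div 2)}" using P v by (intro mem) auto
  have "blowup_parent h \<theta> (?first v) = ?first (v div 2)"
    using 1 v by (auto simp: blowup_parent_def)
  moreover have "?first v \<in> {2..n}" using 1 v \<theta> by auto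
  ultimately have "{?first v, ?first (v div 2)} \<in> blowup_edges h \<theta> n"
    unfolding blowup_edges_def by (metis (no_types, lifting) image_eqI insert_commute)
  then show "\<exists>a\<in>{w \<in> {1..n}. cell_index h \<theta> w = (c, v)}. \<exists>b\<in>{w \<in> {1..n}. cell_index h \<theta> w = (c, v div 2)}.
      {a, b} \<in> blowup_edges h \<theta> n" using 1 2 by blast
qed (use assms in auto)

section \<open>Separators of the union seen in both trees\<close>

lemma separates_union_along:
  assumes "separates (union_along \<phi> E1 E2) A X"
  shows "separates E1 (\<phi> -` A) (\<phi> -` X)" "separates E2 A X"
proof -
  have "b \<in> \<phi> -` A \<union> \<phi> -` X" if "{a, b} \<in> E1" "a \<in> \<phi> -` A" for a b
  proof -
    have "{\<phi> a, \<phi> b} \<in> union_along \<phi> E1 E2" using that by (auto simp: union_along_def map_edges_def)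
    then show ?thesis using assms that by (auto simp: separates_def)
  qed
  then show "separates E1 (\<phi> -` A) (\<phi> -` X)" using assms by (auto simp: separates_def)
  show "separates E2 A X" using assms by (auto simp: separates_def union_along_def)
qed

lemma simple_graph_union_along:
  assumes "\<phi> permutes V" "simple_graph V E1" "simple_graph V E2"
  shows "simple_graph V (union_along \<phi> E1 E2)"
proof -
  have "{\<phi> i, \<phi> j} \<subseteq> V \<and> card {\<phi> i, \<phi> j} = 2" if "{i, j} \<in> E1" for i j
  proof -
    have "{i, j} \<subseteq> V" "card {i, j} = 2" using that assms(2) by (auto simp: simple_graph_def)
    then have "i \<in> V" "j \<in> V" "i \<noteq> j" by (auto simp: card_insert_if split: if_splits)
    then show ?thesis
      using permutes_in_image[OF assms(1)] permutes_inj[OF assms(1)] by (auto simp: card_2_iff inj_eq)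
  qed
  then show ?thesis using assms(2,3) by (auto simp: simple_graph_def union_along_def map_edges_def)
qed

text \<open>Preimages under the bijection \<open>\<phi>\<close> keep cardinalities, so one and the
  same size is realised in both trees.\<close>

lemma separator_in_both_trees:
  assumes \<phi>: "\<phi> permutes V" and G: "simple_graph V E1" "simple_graph V E2"
    and tw: "treewidth V (union_along \<phi> E1 E2) < k" and x: "x \<le> card V" "x > 0"
  shows "\<exists>A1 X1 A2 X2. A1 \<subseteq> V \<and> X1 \<subseteq> V \<and> separates E1 A1 X1 \<and> card X1 \<le> k \<and>
    A2 \<subseteq> V \<and> X2 \<subseteq> V \<and> separates E2 A2 X2 \<and> card X2 \<le> k \<and>
    card A1 = card A2 \<and> x \<le> card A2 + k \<and> card A2 < 2 * x"
proof -
  obtain A X where AX: "A \<subseteq> V" "X \<subseteq> V" "separates (union_along \<phi> E1 E2) A X" "card X \<le> k"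
      "x \<le> card A + k" "card A < 2 * x"
    using treewidth_separator[OF simple_graph_union_along[OF \<phi> G] tw x] by blast
  have c: "card (\<phi> -` S) = card S" for S
    using permutes_inj[OF \<phi>] permutes_surj[OF \<phi>] by (intro card_vimage_inj) auto
  have "\<phi> -` S \<subseteq> V" if "S \<subseteq> V" for S using that permutes_in_image[OF \<phi>] by auto
  then show ?thesis using AX separates_union_along[OF AX(3)] c
    by (intro exI[of _ "\<phi> -` A"] exI[of _ "\<phi> -` X"] exI[of _ A] exI[of _ X]) auto
qed

section \<open>Comparing the two trees\<close>

lemma linear_less_exp: "\<exists>m. a * m + b < (2::nat) ^ m"
proof -
  \<comment> \<open>The witness is \<open>m = 2 * j\<close>, for which \<open>2 ^ m\<close> is at
    least \<open>Suc j * Suc j\<close>.\<close>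
  define j where "j = 2 * a + b"
  have "a * (2 * j) + b \<le> j * j + j"
  proof -
    have "(2 * a) * j \<le> j * j" by (intro mult_right_mono) (auto simp: j_def)
    moreover have "b \<le> j" by (simp add: j_def)
    moreover have "a * (2 * j) = (2 * a) * j" by simp
    ultimately show ?thesis by linarith
  qed
  also have "\<dots> < Suc j * Suc j" by simp
  also have "\<dots> \<le> 2 ^ j * 2 ^ j" by (intro mult_mono) (auto intro: Suc_leI)
  also have "\<dots> = 2 ^ (2 * j)" by (simp add: mult_2 power_add)
  finally show ?thesis by blast
qed

lemma polynomial_less_exp: "\<exists>h. C * (2 * h + 2) ^ d < (2::nat) ^ h"
proof -
  obtain m where m: "d * m + (d + C + 1) < 2 ^ m" using linear_less_exp by blast
  \<comment> \<open>This makes \<open>2 * h + 2\<close> a power of 2; comparing exponents then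
    leaves the linear bound satisfied by \<open>m\<close>.\<close>
  define h :: nat where "h = 2 ^ m - 1"
  have "(2::nat) ^ m > 1" using m by linarith
  then have h: "2 * h + 2 = 2 ^ Suc m" by (auto simp: h_def)
  have "C * (2 * h + 2) ^ d \<le> 2 ^ C * 2 ^ (Suc m * d)"
    unfolding h power_mult by (intro mult_mono) (auto intro: less_imp_le[OF less_exp])
  also have "\<dots> = 2 ^ (C + Suc m * d)" by (simp add: power_add)
  also have "\<dots> < 2 ^ h"
    using m by (intro power_strict_increasing) (auto simp: h_def algebra_simps)
  finally show ?thesis by blast
qed

text \<open>The common size of the two sets lies between \<open>u\<close> and \<open>u + k\<close>
  by the first tree, and between \<open>\<theta> * u'\<close> and \<open>\<theta> * (u' + k)\<close>
  by the second; eliminating it leaves the inequalities. The bound on \<open>2 * x\<close> keeps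
  this size below that of one binary tree.\<close>

lemma blowup_pair_separator_sizes:
  fixes h k \<theta> x :: nat
  defines "n \<equiv> \<theta> * (2 ^ h - 1)"
  assumes \<theta>: "\<theta> > 0" and \<phi>: "\<phi> permutes {1..n}"
    and x: "x > 0" "2 * x \<le> 2 ^ h - 1"
    and tw: "treewidth {1..n} (union_along \<phi> (blowup_edges h 1 n) (blowup_edges h \<theta> n)) < k"
  shows "\<exists>u\<in>sums_of (signed_tree_sizes h) (4 * k). \<exists>u'\<in>sums_of (signed_tree_sizes h) (4 * k).
    int \<theta> * u' \<le> u + int k \<and> u \<le> int \<theta> * (u' + int k) \<and> int x \<le> int \<theta> * (u' + int k) + int k"
proof -
  have "2 ^ h - 1 \<le> n" using \<theta> by (simp add: n_def)
  then have n: "x \<le> n" "n \<ge> 1" using x by linarith+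
  have n1: "n = \<theta> * (2 ^ h - 1) * 1" and n2: "n = 1 * (2 ^ h - 1) * \<theta>" by (simp_all add: n_def)
  have G: "simple_graph {1..n} (blowup_edges h 1 n)" "simple_graph {1..n} (blowup_edges h \<theta> n)"
    using blowup_is_tree[of _ n h] \<theta> n by (auto simp: is_tree_def)
  obtain A1 X1 A2 X2 where AX: "A1 \<subseteq> {1..n}" "X1 \<subseteq> {1..n}" "separates (blowup_edges h 1 n) A1 X1" "card X1 \<le> k"
    "A2 \<subseteq> {1..n}" "X2 \<subseteq> {1..n}" "separates (blowup_edges h \<theta> n) A2 X2" "card X2 \<le> k"
    "card A1 = card A2" "x \<le> card A2 + k" "card A2 < 2 * x"
    using separator_in_both_trees[OF \<phi> G tw, of x] n x by auto
  have small: "card A2 < 2 ^ h - 1" using AX x by linarith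
  obtain u where u: "u \<in> sums_of (signed_tree_sizes h) (4 * k)" "u \<le> int (card A2)" "int (card A2) \<le> u + int k"
    using separated_blowup_edges_card[of 1 A1 \<theta> h X1 k] AX small unfolding n1[symmetric] by auto
  obtain u' where u': "u' \<in> sums_of (signed_tree_sizes h) (4 * k)" "int \<theta> * u' \<le> int (card A2)"
      "int (card A2) \<le> int \<theta> * (u' + int k)"
    using separated_blowup_edges_card[of \<theta> A2 1 h X2 k] AX small \<theta> unfolding n2[symmetric] by auto
  have "int x \<le> int (card A2) + int k" using AX(10) by linarith
  then have "int \<theta> * u' \<le> u + int k \<and> u \<le> int \<theta> * (u' + int k) \<and> int x \<le> int \<theta> * (u' + int k) + int k"
    using u u' by linarith
  then show ?thesis using u(1) u'(1) by blast
qed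

text \<open>If \<open>\<theta>' \<ge> \<theta> + 1\<close>, then \<open>(\<theta> + 1) * u' \<le> u
  + k \<le> \<theta> * u' + \<theta> * k + k\<close> gives
  \<open>u' \<le> (\<theta> + 1) * k\<close>, whereas the scale \<open>x\<close> forces
  \<open>u'\<close> to be larger.\<close>

lemma approx_ratio_unique:
  fixes k M \<theta> \<theta>' x :: nat and u u' :: int
  assumes \<theta>: "\<theta> \<in> {1..2 * M}" "\<theta>' \<in> {1..2 * M}" and x: "x = k + 2 * M * ((2 * M + 1) * k + 1 + k)"
    and l: "int \<theta>' * u' \<le> u + int k" and u: "u \<le> int \<theta> * (u' + int k)"
    and big: "int x \<le> int \<theta> * (u' + int k) + int k"
  shows "\<theta>' \<le> \<theta>"
proof (rule ccontr)
  assume "\<not> \<theta>' \<le> \<theta>"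
  then have lt: "int \<theta> + 1 \<le> int \<theta>'" by linarith
  \<comment> \<open>One more than the upper bound \<open>(2 * M + 1) * k\<close> for
    \<open>u'\<close>; the choice of \<open>x\<close> makes \<open>big\<close> yield
    \<open>u' \<ge> Y\<close>.\<close>
  define Y where "Y = (2 * int M + 1) * int k + 1"
  have "int x = int k + 2 * int M * (Y + int k)" unfolding x Y_def by (simp add: algebra_simps)
  then have b: "2 * int M * (Y + int k) \<le> int \<theta> * (u' + int k)" using big by linarith
  have Y0: "Y > 0" unfolding Y_def by (intro add_nonneg_pos mult_nonneg_nonneg) auto
  have "u' \<ge> Y"
  proof (rule ccontr)
    assume "\<not> u' \<ge> Y"
    then have "u' + int k < Y + int k" by linarith
    then have "int \<theta> * (u' + int k) < int \<theta> * (Y + int k)" using \<theta> by (intro mult_strict_left_mono) auto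
    also have "\<dots> \<le> 2 * int M * (Y + int k)" using \<theta> Y0 by (intro mult_right_mono) auto
    finally show False using b by linarith
  qed
  have "(int \<theta> + 1) * u' \<le> int \<theta>' * u'" using lt \<open>u' \<ge> Y\<close> Y0 by (intro mult_right_mono) auto
  then have "u' \<le> int \<theta> * int k + int k" using l u by (simp add: algebra_simps)
  also have "int \<theta> * int k \<le> 2 * int M * int k" using \<theta> by (intro mult_right_mono) auto
  finally show False using \<open>u' \<ge> Y\<close> unfolding Y_def by (simp add: algebra_simps)
qed

theorem theorem4:
  fixes c :: real
  assumes "c > 0"
  shows "\<exists>(n :: nat) (E1 :: nat set set) (E2 :: nat set set).
    is_tree {1..n} E1 \<and> is_tree {1..n} E2 \<and>
    (\<forall>\<phi>. \<phi> permutes {1..n} \<longrightarrow> real (treewidth {1..n} (union_along \<phi> E1 E2)) \<ge> c)"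
proof (rule ccontr)
  assume contra: "\<not> ?thesis"
  define k where "k = nat \<lceil>c\<rceil>"
  have k: "k \<ge> 1" "c \<le> real k" using assms by (auto simp: k_def le_nat_iff)
  \<comment> \<open>The left side is \<open>136 * (k * N * N)\<close> for the \<open>N\<close>
    below, which bounds \<open>2 * x\<close>; the coefficients of \<open>2 * x\<close> in terms of
    \<open>k\<close> and \<open>N\<close> sum to 58.\<close>
  obtain h where h: "(136 * k) * (2 * h + 2) ^ (16 * k) < 2 ^ h"
    using polynomial_less_exp by blast
  \<comment> \<open>There are at most \<open>(2 * h + 2) ^ (4 * k)\<close> sizes, hence at most
    \<open>N\<close> pairs; \<open>M\<close> multipliers are one too many.\<close>
  define N where "N = (2 * h + 2) ^ (8 * k)"
  define M where "M = N + 1"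
  define x where "x = k + 2 * M * ((2 * M + 1) * k + 1 + k)"
  have x: "2 * x \<le> 2 ^ h - 1"
  proof -
    have N1: "N \<ge> 1" by (simp add: N_def)
    have "1 \<le> k * N * N" "k \<le> k * N * N" "N \<le> k * N * N" "k * N \<le> k * N * N"
      using N1 k by simp_all
    moreover have "2 * x = 4 + 4 * N + 18 * k + 24 * (k * N) + 8 * (k * N * N)"
      unfolding x_def M_def by (simp add: algebra_simps)
    ultimately have "2 * x \<le> 136 * (k * N * N)" by linarith
    also have "\<dots> = (136 * k) * (2 * h + 2) ^ (16 * k)"
      unfolding N_def by (simp add: mult.assoc flip: power_add)
    finally show ?thesis using h by linarith
  qed
  have "x > 0" using k by (simp add: x_def)
  let ?S = "sums_of (signed_tree_sizes h) (4 * k)"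
  let ?rel = "\<lambda>\<theta> (u, u'). int \<theta> * u' \<le> u + int k \<and> u \<le> int \<theta> * (u' + int k) \<and> int x \<le> int \<theta> * (u' + int k) + int k"
  \<comment> \<open>By the negated claim, each multiplier admits a permutation whose union has
    treewidth below \<open>k\<close>, and hence a pair of sizes.\<close>
  have "\<exists>z\<in>?S \<times> ?S. ?rel \<theta> z" if "\<theta> \<in> {1..M}" for \<theta>
  proof -
    define n where "n = \<theta> * (2 ^ h - 1)"
    have "(2::nat) ^ h - 1 \<ge> 1" using x \<open>x > 0\<close> by linarith
    then have "n \<ge> 1" using that by (auto simp: n_def)
    then have trees: "is_tree {1..n} (blowup_edges h 1 n)" "is_tree {1..n} (blowup_edges h \<theta> n)"
      using that by (auto intro!: blowup_is_tree simp del: One_nat_def)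
    have "\<not> (\<forall>\<phi>. \<phi> permutes {1..n} \<longrightarrow>
        c \<le> real (treewidth {1..n} (union_along \<phi> (blowup_edges h 1 n) (blowup_edges h \<theta> n))))"
      using contra[unfolded not_ex, rule_format, of n "blowup_edges h 1 n" "blowup_edges h \<theta> n"]
        trees by (simp only: simp_thms not_False_eq_True)
    then obtain \<phi> where \<phi>: "\<phi> permutes {1..n}"
      and "real (treewidth {1..n} (union_along \<phi> (blowup_edges h 1 n) (blowup_edges h \<theta> n))) < c"
      by (auto simp: not_le)
    then have "treewidth {1..n} (union_along \<phi> (blowup_edges h 1 n) (blowup_edges h \<theta> n)) < k"
      using k by linarith
    from blowup_pair_separator_sizes[OF _ \<phi>[unfolded n_def] \<open>x > 0\<close> x this[unfolded n_def]]
    show ?thesis using that by fastforce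
  qed
  then have "\<forall>\<theta>\<in>{1..M}. \<exists>z. z \<in> ?S \<times> ?S \<and> ?rel \<theta> z" by blast
  from bchoice[OF this]
  obtain z where z0: "\<forall>\<theta>\<in>{1..M}. z \<theta> \<in> ?S \<times> ?S \<and> ?rel \<theta> (z \<theta>)" ..
  note z = bspec[OF z0]
  \<comment> \<open>Used in both orders, this makes multipliers with the same pair equal, so
    \<open>z\<close> is injective.\<close>
  have le: "\<theta>' \<le> \<theta>" if "\<theta> \<in> {1..M}" "\<theta>' \<in> {1..M}" "z \<theta> = z \<theta>'" for \<theta> \<theta>'
  proof -
    obtain u u' where "z \<theta> = (u, u')" by force
    then show ?thesis using z[OF that(1)] z[OF that(2)] that
      by (intro approx_ratio_unique[OF _ _ x_def, of \<theta> \<theta>' u' u]) auto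
  qed
  have "inj_on z {1..M}"
    by (intro inj_onI antisym le) (simp_all only: simp_thms)
  moreover have "z ` {1..M} \<subseteq> ?S \<times> ?S"
    by (rule image_subsetI) (rule conjunct1[OF z])
  moreover have "finite (?S \<times> ?S)" by (simp add: finite_sums_of finite_signed_tree_sizes)
  ultimately have "card {1..M} \<le> card (?S \<times> ?S)" by (rule card_inj_on_le)
  then have "M \<le> card (?S \<times> ?S)" by simp
  also have "\<dots> \<le> (2 * h + 2) ^ (4 * k) * (2 * h + 2) ^ (4 * k)"
  proof -
    have "card ?S \<le> card (signed_tree_sizes h) ^ (4 * k)" using card_sums_of finite_signed_tree_sizes .
    also have "\<dots> \<le> (2 * h + 2) ^ (4 * k)" using card_signed_tree_sizes by (rule power_mono) simp
    finally have le: "card ?S \<le> (2 * h + 2) ^ (4 * k)" .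
    show ?thesis unfolding card_cartesian_product by (intro mult_mono le zero_le)
  qed
  also have "\<dots> = N" unfolding N_def power_add[symmetric] by simp
  finally show False by (simp add: M_def)
qed

end
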